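(* Let $\mathbf X\in\mathbb R^{n\times d}$ with $d\le n$ and $\det(\mathbf X^\top\mathbf X)>0$, and let $\mathbf x_i^\top$ denote its $i$-th row. For any set $S\subseteq\{1,\dots,n\}$ of size $s>d$ with $\det(\mathbf X_S^\top\mathbf X_S)>0$ define, for $i\in S$, $$P(S_{-i}\,|\,S)=\frac{\det(\mathbf X_{S_{-i}}^\top\mathbf X_{S_{-i}})}{(s-d)\det(\mathbf X_S^\top\mathbf X_S)}=\frac{1-\mathbf x_i^\top(\mathbf X_S^\top\mathbf X_S)^{-1}\mathbf x_i}{s-d}$$ (the two expressions being equal), and if $\det(\mathbf X_S^\top\mathbf X_S)=0$ set $P(S_{-i}|S)=\frac1s$. Then, when $\det(\mathbf X_S^\top\mathbf X_S)>0$, $P(S_{-i}|S)$, $i\in S$, is a proper probability distribution. Moreover $\sum_{S:|S|=s}P(S)=1$ for all $s\in\{d,\dots,n\}$, and for any $S$ of size $s\ge d$ the probability $P(S)$ of all paths from the root $\{1,\dots,n\}$ to $S$ is $$P(S)=\frac{\det(\mathbf X_S^\top\mathbf X_S)}{\binom{n-d}{s-d}\det(\mathbf X^\top\mathbf X)}.$$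
   Context: $S_{-i}=S\setminus\{i\}$, and $\mathbf X_S$ is the submatrix of rows of $\mathbf X$ indexed by $S$. Consider the directed acyclic graph whose nodes are the subsets $S\subseteq\{1,\dots,n\}$ with $d\le|S|\le n$, with an edge from each $S$ with $|S|>d$ to each $S_{-i}$, $i\in S$, labeled by $P(S_{-i}|S)$. The probability of a directed path is the product of its edge labels; $P(S)$ is the sum of the probabilities of all directed paths from the root $\{1,\dots,n\}$ to $S$, with $P(\{1,\dots,n\})=1$. *)

theory Defs
  imports "Jordan_Normal_Form.Determinant" "Jordan_Normal_Form.Gauss_Jordan_Elimination"
    "Jordan_Normal_Form.DL_Submatrix"
    "Graph_Theory.Pair_Digraph"
begin

text \<open>
  Row indices of an \<open>n \<times> d\<close> matrix run over \<open>{0..<n}\<close>, as usual for \<^typ>\<open>real mat\<close>;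
  the index set \<open>{1,\<dots>,n}\<close> becomes \<open>{0..<n}\<close>.
\<close>

definition rows_submatrix :: "real mat \<Rightarrow> nat set \<Rightarrow> real mat" where
  "rows_submatrix X S = submatrix X S UNIV"

definition gram :: "real mat \<Rightarrow> real mat" where
  "gram A = transpose_mat A * A"

text \<open>The edge label \<open>P(T | S)\<close>, meaningful for \<open>T = S - {i}\<close> with \<open>i \<in> S\<close> and \<open>card S > d\<close>.\<close>

definition edge_prob :: "real mat \<Rightarrow> nat set \<Rightarrow> nat set \<Rightarrow> real" where
  "edge_prob X T S =
     (if det (gram (rows_submatrix X S)) > 0
      then det (gram (rows_submatrix X T)) /
             ((real (card S) - real (dim_col X)) * det (gram (rows_submatrix X S)))
      else 1 / real (card S))"

definition removal_dag :: "real mat \<Rightarrow> nat set pair_pre_digraph" where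
  "removal_dag X =
     \<lparr> pverts = {S. S \<subseteq> {0..<dim_row X} \<and> dim_col X \<le> card S},
       parcs = {(S, S - {i}) | S i. S \<subseteq> {0..<dim_row X} \<and> dim_col X < card S \<and> i \<in> S} \<rparr>"

text \<open>A path is the list of its edges.\<close>

definition path_prob :: "real mat \<Rightarrow> (nat set \<times> nat set) list \<Rightarrow> real" where
  "path_prob X p = (\<Prod>(S, T)\<leftarrow>p. edge_prob X T S)"

text \<open>
  The root is reached from itself only by the empty path, whose probability is \<open>1\<close>; hence
  \<open>P({1,\<dots>,n}) = 1\<close> (lemma \<open>node_prob_root\<close> below). The sum is finite by \<open>finite_paths\<close>.
\<close>

definition node_prob :: "real mat \<Rightarrow> nat set \<Rightarrow> real" where
  "node_prob X S =
     (\<Sum>p | pre_digraph.apath (with_proj (removal_dag X)) {0..<dim_row X} p S. path_prob X p)"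

lemma pair_fin_digraph_removal_dag: "pair_fin_digraph (removal_dag X)"
proof
  have fin: "finite (Pow {0..<dim_row X})"
    by simp
  show "finite (pverts (removal_dag X))"
    by (rule finite_subset[OF _ fin]) (auto simp: removal_dag_def)
  show "finite (parcs (removal_dag X))"
    by (rule finite_subset[of _ "Pow {0..<dim_row X} \<times> Pow {0..<dim_row X}"])
       (auto simp: removal_dag_def)
next
  fix e assume "e \<in> parcs (removal_dag X)"
  then obtain S i where "e = (S, S - {i})" "S \<subseteq> {0..<dim_row X}" "dim_col X < card S" "i \<in> S"
    by (auto simp: removal_dag_def)
  moreover from this have "finite S"
    using finite_subset by blast
  ultimately show "fst e \<in> pverts (removal_dag X)" "snd e \<in> pverts (removal_dag X)"
    by (auto simp: removal_dag_def)
qed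

lemma finite_paths:
  "finite {p. pre_digraph.apath (with_proj (removal_dag X)) {0..<dim_row X} p S}"
proof -
  interpret pair_fin_digraph "removal_dag X"
    by (rule pair_fin_digraph_removal_dag)
  show ?thesis
    by (rule apaths_finite)
qed

lemma node_prob_root:
  assumes "dim_col X \<le> dim_row X"
  shows "node_prob X {0..<dim_row X} = 1"
proof -
  interpret pair_fin_digraph "removal_dag X"
    by (rule pair_fin_digraph_removal_dag)
  let ?r = "{0..<dim_row X}"
  have root: "?r \<in> pverts (removal_dag X)"
    using assms by (simp add: removal_dag_def)
  have "{p. apath ?r p ?r} = {[]}"
  proof (intro equalityI subsetI)
    fix p assume p: "p \<in> {p. apath ?r p ?r}"
    show "p \<in> {[]}"
    proof (cases p)
      case (Cons e es)
      with p have w: "awalk (snd e) es ?r" and dist: "distinct (awalk_verts ?r p)" and e: "fst e = ?r"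
        by (auto simp: apath_def awalk_Cons_iff)
      have ends: "cas u q v \<Longrightarrow> v \<in> set (awalk_verts u q)" for u q v
        by (induction q arbitrary: u) auto
      from w have "?r \<in> set (awalk_verts (snd e) es)"
        by (intro ends) (simp add: awalk_def)
      with dist e Cons show ?thesis by simp
    qed simp
  qed (use root in \<open>simp add: apath_Nil_iff\<close>)
  then show ?thesis
    by (simp add: node_prob_def path_prob_def)
qed

end

theory Submission
  imports Defs "Jordan_Normal_Form.Char_Poly"
begin

text \<open>
  Write \<open>G S\<close> for the determinant of the Gram matrix of the rows in \<open>S\<close>. Deleting row \<open>i\<close> is a
  rank-one update, so \<open>G (S - {i}) = G S * (1 - leverage of i)\<close>; the leverage scores sum to \<open>d\<close>,
  whence \<open>\<Sum>i\<in>S. G (S - {i}) = (card S - d) * G S\<close>, which also holds for \<open>G S = 0\<close> because then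
  all its subsets are singular as well. Conditioning on the last edge of a path, the formula for
  \<open>P(S)\<close> follows by induction on the number of deleted rows: each of the \<open>n - card S\<close>
  predecessors of \<open>S\<close> contributes the same amount, since its own determinant cancels.
\<close>

section \<open>Gram matrices: kernel and sign of the determinant\<close>

lemma scalar_prod_self_nonneg: "0 \<le> (v :: real vec) \<bullet> v"
  by (auto simp: scalar_prod_def intro: sum_nonneg)

lemma scalar_prod_self_eq_0_iff:
  fixes v :: "real vec"
  shows "v \<in> carrier_vec n \<Longrightarrow> v \<bullet> v = 0 \<longleftrightarrow> v = 0\<^sub>v n"
  by (auto simp: scalar_prod_def sum_nonneg_eq_0_iff intro!: eq_vecI)

lemma gram_carrier_mat [simp]: "A \<in> carrier_mat m d \<Longrightarrow> gram A \<in> carrier_mat d d"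
  by (simp add: gram_def)

lemma gram_quadratic_form:
  assumes "A \<in> carrier_mat m d" "v \<in> carrier_vec d"
  shows "(gram A *\<^sub>v v) \<bullet> v = (A *\<^sub>v v) \<bullet> (A *\<^sub>v v)"
proof -
  have "gram A *\<^sub>v v = transpose_mat A *\<^sub>v (A *\<^sub>v v)"
    unfolding gram_def using assms by (intro assoc_mult_mat_vec) auto
  then show ?thesis
    using transpose_vec_mult_scalar[OF assms(1,2), of "A *\<^sub>v v"] assms by simp
qed

text \<open>Pairing with \<open>v\<close> turns \<open>gram A *\<^sub>v v = 0\<^sub>v d\<close> into
  a vanishing squared norm of \<open>A *\<^sub>v v\<close>, which over the reals forces that vector
  to vanish. Singularity of the Gram matrix can thus be read off the kernel of
  \<open>A\<close>.\<close>

lemma gram_mult_vec_eq_0_iff: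
  assumes "A \<in> carrier_mat m d" "v \<in> carrier_vec d"
  shows "gram A *\<^sub>v v = 0\<^sub>v d \<longleftrightarrow> A *\<^sub>v v = 0\<^sub>v m"
proof
  assume "gram A *\<^sub>v v = 0\<^sub>v d"
  then have "(A *\<^sub>v v) \<bullet> (A *\<^sub>v v) = 0"
    using gram_quadratic_form[OF assms] assms by simp
  then show "A *\<^sub>v v = 0\<^sub>v m"
    using assms by (subst (asm) scalar_prod_self_eq_0_iff[of _ m]) auto
next
  assume "A *\<^sub>v v = 0\<^sub>v m"
  moreover have "gram A *\<^sub>v v = transpose_mat A *\<^sub>v (A *\<^sub>v v)"
    unfolding gram_def using assms by (intro assoc_mult_mat_vec) auto
  ultimately show "gram A *\<^sub>v v = 0\<^sub>v d"
    using assms by (auto intro!: eq_vecI)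
qed

lemma det_gram_eq_0_iff:
  assumes "A \<in> carrier_mat m d"
  shows "det (gram A) = 0 \<longleftrightarrow> (\<exists>v \<in> carrier_vec d. v \<noteq> 0\<^sub>v d \<and> A *\<^sub>v v = 0\<^sub>v m)"
  unfolding det_0_iff_vec_prod_zero_field[OF gram_carrier_mat[OF assms]]
  using gram_mult_vec_eq_0_iff[OF assms] by metis

text \<open>
  If the determinant were negative, then \<open>t \<mapsto> det (t I + gram A)\<close>, which is monic, would have
  a positive root, so \<open>gram A\<close> would have a negative eigenvalue.
\<close>
lemma det_gram_nonneg:
  assumes A: "A \<in> carrier_mat m d"
  shows "0 \<le> det (gram A)"
proof (rule ccontr)
  let ?G = "gram A" and ?p = "char_poly (- gram A)"
  have G: "?G \<in> carrier_mat d d" and G': "- ?G \<in> carrier_mat d d"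
    using A by simp_all
  assume "\<not> 0 \<le> det ?G"
  moreover have "- char_matrix (- ?G) 0 = ?G"
    using G by (auto simp: char_matrix_def intro!: eq_matI)
  ultimately have "poly ?p 0 < 0"
    using char_poly_matrix[OF G', of 0] by simp
  moreover have "lead_coeff ?p = 1"
    using degree_monic_char_poly[OF G'] by simp
  then obtain b where b: "\<And>x. b \<le> x \<Longrightarrow> 1 \<le> poly ?p x"
    using poly_pinfty_gt_lc[of ?p] by auto
  \<comment> \<open>The bound \<open>b\<close> may be negative; \<open>max b 1\<close> is a right
    endpoint that certainly lies beyond 0.\<close>
  then have "poly ?p (max b 1) > 0"
    by (smt (verit) max.cobounded1)
  ultimately obtain t where t: "t > 0" "poly ?p t = 0"
    using poly_IVT_pos[of 0 "max b 1" ?p] by (auto simp: max_def split: if_splits)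
  then have "eigenvalue (- ?G) t"
    using eigenvalue_root_char_poly[OF G'] by simp
  then obtain v where v: "v \<in> carrier_vec d" "v \<noteq> 0\<^sub>v d" "(- ?G) *\<^sub>v v = t \<cdot>\<^sub>v v"
    using G by (auto simp: eigenvalue_def eigenvector_def)
  \<comment> \<open>Pairing the eigenvector equation with \<open>v\<close> equates minus the squared
    norm of \<open>A *\<^sub>v v\<close> with \<open>t\<close> times that of \<open>v\<close>, which
    is absurd for \<open>t > 0\<close>.\<close>
  have "(- ?G) *\<^sub>v v = - (?G *\<^sub>v v)"
    using G v(1) by (intro eq_vecI) auto
  then have "- ((?G *\<^sub>v v) \<bullet> v) = t * (v \<bullet> v)"
    using v G by (metis scalar_prod_smult_left scalar_prod_uminus_left carrier_vecD mult_mat_vec_carrier)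
  then have "t * (v \<bullet> v) \<le> 0"
    using gram_quadratic_form[OF A v(1)] scalar_prod_self_nonneg[of "A *\<^sub>v v"] by simp
  moreover have "v \<bullet> v > 0"
    using scalar_prod_self_nonneg[of v] scalar_prod_self_eq_0_iff[OF v(1)] v(2) by simp
  ultimately show False
    using t(1) by (simp add: mult_le_0_iff)
qed

section \<open>Tools: a determinant identity, inverses, binomial coefficients, enumeration of a
  set\<close>

text \<open>A form of the Weinstein-Aronszajn identity. Both sides are the determinant of the block
  matrix \<open>?M\<close>: the unitriangular factors \<open>?L\<close> and \<open>?R\<close> each
  clear one off-diagonal block. Writing the update as \<open>A * U * V\<close> lets
  \<open>det A\<close> factor out without an inverse.\<close>

lemma det_minus_mult_mult:
  fixes A :: "'a :: idom mat"
  assumes A: "A \<in> carrier_mat n n" and U: "U \<in> carrier_mat n m" and V: "V \<in> carrier_mat m n"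
  shows "det (A - A * U * V) = det A * det (1\<^sub>m m - V * U)"
proof -
  let ?M = "four_block_mat A (A * U) V (1\<^sub>m m)"
  let ?L = "four_block_mat (1\<^sub>m n) (0\<^sub>m n m) (- V) (1\<^sub>m m)"
  let ?R = "four_block_mat (1\<^sub>m n) (- U) (0\<^sub>m m n) (1\<^sub>m m)"
  have M: "?M \<in> carrier_mat (n + m) (n + m)" and L: "?L \<in> carrier_mat (n + m) (n + m)"
    and R: "?R \<in> carrier_mat (n + m) (n + m)"
    using assms by auto
  have AU: "A * U \<in> carrier_mat n m"
    using A U by simp
  have "?M * ?L = four_block_mat (A - A * U * V) (A * U) (0\<^sub>m m n) (1\<^sub>m m)"
    using A U V AU
    by (subst mult_four_block_mat[of _ n n _ m _ m _ _ n _ m])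
       (auto intro!: arg_cong4[of _ _ _ _ _ _ _ _ four_block_mat] eq_matI)
  moreover have "det ?L = 1"
    using V by (subst det_four_block_mat_upper_right_zero[of _ n _ m]) auto
  ultimately have 1: "det ?M = det (A - A * U * V)"
    using det_mult[OF M L] AU
      det_four_block_mat_lower_left_zero[OF _ AU refl one_carrier_mat, of "A - A * U * V"]
      minus_carrier_mat[OF mult_carrier_mat[OF AU V]]
    by simp
  have "?M * ?R = four_block_mat A (0\<^sub>m n m) V (1\<^sub>m m - V * U)"
    using A U V AU
    by (subst mult_four_block_mat[of _ n n _ m _ m _ _ n _ m])
       (auto intro!: arg_cong4[of _ _ _ _ _ _ _ _ four_block_mat] eq_matI)
  moreover have "det ?R = 1"
    using U by (subst det_four_block_mat_lower_left_zero[of _ n _ m]) auto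
  ultimately have 2: "det ?M = det A * det (1\<^sub>m m - V * U)"
    using det_mult[OF M R] U V
      det_four_block_mat_upper_right_zero[OF A refl V minus_carrier_mat[OF mult_carrier_mat[OF V U]], of "1\<^sub>m m"]
    by simp
  show ?thesis
    using 1 2 by simp
qed

lemma mat_inverse_of_det_nonzero:
  fixes A :: "'a :: field mat"
  assumes A: "A \<in> carrier_mat n n" and "det A \<noteq> 0" and B: "B = the (mat_inverse A)"
  shows "A * B = 1\<^sub>m n" "B * A = 1\<^sub>m n" "B \<in> carrier_mat n n"
proof -
  \<comment> \<open>The two library facts speak of units of a matrix ring with a free parameter
    \<open>?b\<close>; fixing it to \<open>()\<close> makes the rings coincide.\<close>
  have "mat_inverse A \<noteq> None"
    using mat_inverse(1)[OF A, where ?b = "()"] det_non_zero_imp_unit[OF assms(1,2), where ?b = "()"]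
    by blast
  then have "mat_inverse A = Some B"
    using B by auto
  from mat_inverse(2)[OF A this]
  show "A * B = 1\<^sub>m n" "B * A = 1\<^sub>m n" "B \<in> carrier_mat n n" by auto
qed

text \<open>Both sides equal \<open>(n - d) * ((n - d - 1) choose (s - d))\<close>. This is the
  change in the normalising constant when one row is deleted.\<close>

lemma binomial_step:
  assumes "d \<le> s" "s < n"
  shows "(s + 1 - d) * ((n - d) choose (s + 1 - d)) = (n - s) * ((n - d) choose (s - d))"
proof -
  have eqs: "n - s = n - d - (s - d)" "s + 1 - d = Suc (s - d)"
    using assms by auto
  show ?thesis
    unfolding eqs binomial_absorb_comp binomial_absorption ..
qed

text \<open>Row \<open>r\<close> of a submatrix is row \<open>pick S r\<close> of \<open>X\<close>;
  the bijection turns sums over positions into sums over original indices.\<close>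

lemma bij_betw_pick:
  assumes "finite S"
  shows "bij_betw (pick S) {0..<card S} S"
proof (rule bij_betw_imageI)
  have "\<And>i j. i < j \<Longrightarrow> j < card S \<Longrightarrow> pick S i < pick S j"
    using pick_mono_le by blast
  then show inj: "inj_on (pick S) {0..<card S}"
    by (intro linorder_inj_onI) (metis atLeastLessThan_iff order.strict_implies_not_eq, force)
  show "pick S ` {0..<card S} = S"
    using assms inj by (intro card_subset_eq) (auto simp: card_image pick_in_set_le)
qed

section \<open>Gram determinants of row submatrices of a fixed matrix\<close>

context
  fixes X :: "real mat" and n d :: nat
  assumes X: "X \<in> carrier_mat n d"
begin

lemma rows_submatrix_carrier:
  assumes "S \<subseteq> {0..<n}"
  shows "rows_submatrix X S \<in> carrier_mat (card S) d"
proof -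
  have "{i. i < n \<and> i \<in> S} = S"
    using assms by auto
  with X show ?thesis
    unfolding rows_submatrix_def by (intro carrier_matI) (simp_all add: dim_submatrix)
qed

lemma rows_submatrix_index:
  assumes "S \<subseteq> {0..<n}" "r < card S" "j < d"
  shows "rows_submatrix X S $$ (r, j) = X $$ (pick S r, j)"
proof -
  have "{i. i < n \<and> i \<in> S} = S"
    using assms by auto
  then show ?thesis
    using assms X unfolding rows_submatrix_def by (subst submatrix_index) (auto simp: pick_UNIV)
qed

lemma rows_submatrix_all: "rows_submatrix X {0..<n} = X"
proof -
  have "pick {0..<n} i = i" if "i < n" for i
    using pick_reduce_set[of i n UNIV] that by (simp add: pick_UNIV lessThan_def atLeast0LessThan)
  then show ?thesis
    using X by (intro eq_matI) (auto simp: rows_submatrix_def submatrix_def pick_UNIV)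
qed

text \<open>The Gram matrix as a sum of outer products of rows: row positions disappear, and
  deleting an index subtracts a single rank-one term.\<close>

lemma gram_rows_submatrix:
  assumes S: "S \<subseteq> {0..<n}"
  shows "gram (rows_submatrix X S) = mat d d (\<lambda>(j, k). \<Sum>i\<in>S. X $$ (i, j) * X $$ (i, k))"
proof (rule eq_matI)
  note M = rows_submatrix_carrier[OF S]
  fix j k assume "j < dim_row (mat d d (\<lambda>(j, k). \<Sum>i\<in>S. X $$ (i, j) * X $$ (i, k)))"
    "k < dim_col (mat d d (\<lambda>(j, k). \<Sum>i\<in>S. X $$ (i, j) * X $$ (i, k)))"
  then have jk: "j < d" "k < d" by auto
  have fin: "finite S" using S finite_subset by blast
  have "gram (rows_submatrix X S) $$ (j, k)
      = (\<Sum>r=0..<card S. X $$ (pick S r, j) * X $$ (pick S r, k))"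
    using M jk S by (auto simp: gram_def scalar_prod_def rows_submatrix_index)
  also have "\<dots> = (\<Sum>i\<in>S. X $$ (i, j) * X $$ (i, k))"
    by (rule sum.reindex_bij_betw[OF bij_betw_pick[OF fin]])
  finally show "gram (rows_submatrix X S) $$ (j, k)
      = mat d d (\<lambda>(j, k). \<Sum>i\<in>S. X $$ (i, j) * X $$ (i, k)) $$ (j, k)"
    using jk by simp
qed (use rows_submatrix_carrier[OF S] in \<open>auto simp: gram_def\<close>)

lemma gram_rows_submatrix_carrier:
  "S \<subseteq> {0..<n} \<Longrightarrow> gram (rows_submatrix X S) \<in> carrier_mat d d"
  by (rule gram_carrier_mat[OF rows_submatrix_carrier])

lemma rows_submatrix_mult_vec_eq_0_iff:
  assumes S: "S \<subseteq> {0..<n}" and v: "v \<in> carrier_vec d"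
  shows "rows_submatrix X S *\<^sub>v v = 0\<^sub>v (card S) \<longleftrightarrow> (\<forall>i\<in>S. row X i \<bullet> v = 0)"
proof -
  have fin: "finite S" using S finite_subset by blast
  note M = rows_submatrix_carrier[OF S]
  have "(rows_submatrix X S *\<^sub>v v) $ r = row X (pick S r) \<bullet> v" if "r < card S" for r
    using that M v X S pick_in_set_le[OF that]
    by (auto simp: scalar_prod_def rows_submatrix_index intro!: sum.cong)
  then have "rows_submatrix X S *\<^sub>v v = 0\<^sub>v (card S) \<longleftrightarrow> (\<forall>r\<in>{0..<card S}. row X (pick S r) \<bullet> v = 0)"
    using M by (auto simp: vec_eq_iff)
  also have "\<dots> \<longleftrightarrow> (\<forall>i\<in>pick S ` {0..<card S}. row X i \<bullet> v = 0)"
    by auto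
  also have "pick S ` {0..<card S} = S"
    using bij_betw_pick[OF fin] by (simp add: bij_betw_def)
  finally show ?thesis .
qed

lemma det_gram_rows_submatrix_nonneg:
  "S \<subseteq> {0..<n} \<Longrightarrow> 0 \<le> det (gram (rows_submatrix X S))"
  by (rule det_gram_nonneg[OF rows_submatrix_carrier])

text \<open>A nonzero vector orthogonal to all rows indexed by \<open>S\<close> is orthogonal to
  those indexed by \<open>T\<close>, so a kernel vector is inherited.\<close>

lemma det_gram_rows_submatrix_eq_0_mono:
  assumes "T \<subseteq> S" "S \<subseteq> {0..<n}" "det (gram (rows_submatrix X S)) = 0"
  shows "det (gram (rows_submatrix X T)) = 0"
proof -
  have T: "T \<subseteq> {0..<n}" using assms by blast
  obtain v where v: "v \<in> carrier_vec d" "v \<noteq> 0\<^sub>v d" "\<forall>i\<in>S. row X i \<bullet> v = 0"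
    using assms(3) det_gram_eq_0_iff[OF rows_submatrix_carrier[OF assms(2)]]
      rows_submatrix_mult_vec_eq_0_iff[OF assms(2)] by metis
  with assms(1) have "\<forall>i\<in>T. row X i \<bullet> v = 0" by blast
  then show ?thesis
    using v T det_gram_eq_0_iff[OF rows_submatrix_carrier[OF T]]
      rows_submatrix_mult_vec_eq_0_iff[OF T] by metis
qed

lemma det_gram_rows_submatrix_remove:
  assumes S: "S \<subseteq> {0..<n}" and i: "i \<in> S" and nz: "det (gram (rows_submatrix X S)) \<noteq> 0"
  shows "det (gram (rows_submatrix X (S - {i}))) = det (gram (rows_submatrix X S)) *
    (1 - row X i \<bullet> (the (mat_inverse (gram (rows_submatrix X S))) *\<^sub>v row X i))"
proof -
  let ?A = "gram (rows_submatrix X S)"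
  define B where "B = the (mat_inverse ?A)"
  note A = gram_rows_submatrix_carrier[OF S]
  note B = mat_inverse_of_det_nonzero[OF A nz B_def]
  let ?x = "row X i"
  \<comment> \<open>With \<open>x\<close> the deleted row, \<open>U\<close> is \<open>B\<close>
    times \<open>x\<close>, so that \<open>?A * U\<close> is the column \<open>x\<close> and
    \<open>?A * U * V\<close> is the outer product to be subtracted.\<close>
  define U where "U = B * mat d 1 (\<lambda>(j, _). ?x $ j)"
  define V where "V = mat 1 d (\<lambda>(_, j). ?x $ j)"
  have x: "?x \<in> carrier_vec d" using X by auto
  have "i < n" using S i by auto
  have U: "U \<in> carrier_mat d 1" and V: "V \<in> carrier_mat 1 d"
    using B(3) by (auto simp: U_def V_def)
  have "?A * U = ?A * B * mat d 1 (\<lambda>(j, _). ?x $ j)"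
    unfolding U_def using A B(3) by (intro assoc_mult_mat[symmetric]) auto
  then have AU: "?A * U = mat d 1 (\<lambda>(j, _). ?x $ j)"
    using B(1) by simp
  have fin: "finite S" using S finite_subset by blast
  have "gram (rows_submatrix X (S - {i})) = ?A - ?A * U * V"
    unfolding AU using S i fin X \<open>i < n\<close>
    by (subst (1 2) gram_rows_submatrix)
       (auto simp: V_def scalar_prod_def sum_diff1 intro!: eq_matI)
  moreover have "det (1\<^sub>m 1 - V * U) = 1 - ?x \<bullet> (B *\<^sub>v ?x)"
  proof -
    have "row V 0 = ?x" "col U 0 = B *\<^sub>v ?x"
      using X B(3) by (auto simp: V_def U_def scalar_prod_def intro!: eq_vecI sum.cong)
    then show ?thesis
      using U V by (subst det_single) auto
  qed
  ultimately show ?thesis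
    using det_minus_mult_mult[OF A U V] by (simp add: B_def)
qed

text \<open>The leverage scores sum to the trace of \<open>B * gram\<close>, with \<open>B\<close> the inverse of \<open>gram\<close>.\<close>
lemma sum_leverage:
  assumes S: "S \<subseteq> {0..<n}" and nz: "det (gram (rows_submatrix X S)) \<noteq> 0"
  shows "(\<Sum>i\<in>S. row X i \<bullet> (the (mat_inverse (gram (rows_submatrix X S))) *\<^sub>v row X i)) = real d"
proof -
  let ?A = "gram (rows_submatrix X S)"
  define B where "B = the (mat_inverse ?A)"
  note B = mat_inverse_of_det_nonzero[OF gram_rows_submatrix_carrier[OF S] nz B_def]
  have "(\<Sum>i\<in>S. row X i \<bullet> (B *\<^sub>v row X i))
      = (\<Sum>i\<in>S. \<Sum>j<d. \<Sum>k<d. B $$ (j, k) * (X $$ (i, k) * X $$ (i, j)))"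
  proof (rule sum.cong[OF refl])
    fix i assume "i \<in> S"
    then have "i < n" using S by auto
    then show "row X i \<bullet> (B *\<^sub>v row X i)
        = (\<Sum>j<d. \<Sum>k<d. B $$ (j, k) * (X $$ (i, k) * X $$ (i, j)))"
      using X B(3) by (auto simp: scalar_prod_def sum_distrib_left ac_simps lessThan_atLeast0 intro!: sum.cong)
  qed
  \<comment> \<open>Moving the sum over \<open>i\<close> innermost produces entry
    \<open>(k, j)\<close> of \<open>?A\<close>, so that the sum over \<open>k\<close> becomes a
    matrix product.\<close>
  also have "\<dots> = (\<Sum>j<d. \<Sum>k<d. B $$ (j, k) * (\<Sum>i\<in>S. X $$ (i, k) * X $$ (i, j)))"
    by (subst sum.swap, rule sum.cong[OF refl], subst sum.swap) (simp add: sum_distrib_left)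
  also have "\<dots> = (\<Sum>j<d. (B * ?A) $$ (j, j))"
    using B(3) gram_rows_submatrix[OF S] by (auto simp: scalar_prod_def lessThan_atLeast0 intro!: sum.cong)
  also have "\<dots> = real d"
    by (simp add: B(2))
  finally show ?thesis by (simp add: B_def)
qed

lemma sum_det_gram_remove:
  assumes S: "S \<subseteq> {0..<n}"
  shows "(\<Sum>i\<in>S. det (gram (rows_submatrix X (S - {i})))) =
    (real (card S) - real d) * det (gram (rows_submatrix X S))"
proof (cases "det (gram (rows_submatrix X S)) = 0")
  case True
  then show ?thesis
    using det_gram_rows_submatrix_eq_0_mono[OF Diff_subset S] by simp
next
  case False
  then show ?thesis
    by (simp add: det_gram_rows_submatrix_remove[OF S] sum_distrib_left[symmetric] sum_subtractf sum_leverage[OF S])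
qed

text \<open>For \<open>s = d\<close> this is the Cauchy-Binet formula for \<open>gram X\<close>.
  Induction runs downward from \<open>s = n\<close>, double counting pairs of a set and an index
  outside it.\<close>

lemma sum_det_gram_card:
  assumes "d \<le> s" "s \<le> n"
  shows "(\<Sum>S | S \<subseteq> {0..<n} \<and> card S = s. det (gram (rows_submatrix X S))) =
    real ((n - d) choose (s - d)) * det (gram X)"
  using assms
proof (induction "n - s" arbitrary: s)
  case 0
  then have "s = n" by simp
  moreover have "{S. S \<subseteq> {0..<n} \<and> card S = n} = {{0..<n}}"
    using card_subset_eq[of "{0..<n}"] by auto
  ultimately show ?case
    by (simp add: rows_submatrix_all)
next
  case (Suc k)
  let ?g = "\<lambda>S. det (gram (rows_submatrix X S))"
  define F where "F s = {S. S \<subseteq> {0..<n} \<and> card S = s}" for s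
  have s: "s < n" using Suc.hyps by simp
  have fin_F: "finite (F t)" for t
    unfolding F_def by (rule finite_subset[of _ "Pow {0..<n}"]) auto
  have fin: "\<forall>S\<in>F t. finite S" for t
    using finite_subset by (auto simp: F_def)
  have "real (n - s) * (\<Sum>S\<in>F s. ?g S) = (\<Sum>S\<in>F s. \<Sum>i\<in>{0..<n} - S. ?g S)"
    unfolding sum_distrib_left
    by (rule sum.cong[OF refl]) (auto simp: F_def card_Diff_subset finite_subset)
  also have "\<dots> = (\<Sum>(S, i)\<in>Sigma (F s) (\<lambda>S. {0..<n} - S). ?g S)"
    by (rule sum.Sigma) (auto simp: fin_F)
  \<comment> \<open>A pair \<open>(S, i)\<close> with \<open>i\<close> outside \<open>S\<close>
    corresponds to \<open>(T, i)\<close> with \<open>i\<close> in \<open>T\<close>, through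
    \<open>T = insert i S\<close>.\<close>
  also have "\<dots> = (\<Sum>(T, i)\<in>Sigma (F (Suc s)) (\<lambda>T. T). ?g (T - {i}))"
    by (rule sum.reindex_bij_witness[of _ "\<lambda>(T, i). (T - {i}, i)" "\<lambda>(S, i). (insert i S, i)"])
       (auto simp: F_def insert_absorb card_insert_if finite_subset)
  also have "\<dots> = (\<Sum>T\<in>F (Suc s). \<Sum>i\<in>T. ?g (T - {i}))"
    by (rule sum.Sigma[symmetric]) (use fin fin_F in auto)
  also have "\<dots> = (\<Sum>T\<in>F (Suc s). real (s + 1 - d) * ?g T)"
    using Suc.prems by (intro sum.cong[OF refl]) (auto simp: F_def sum_det_gram_remove of_nat_diff)
  also have "\<dots> = real (s + 1 - d) * (real ((n - d) choose (s + 1 - d)) * det (gram X))"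
    using Suc.hyps(1)[of "Suc s"] Suc.hyps(2) Suc.prems s by (simp add: F_def sum_distrib_left[symmetric])
  also have "\<dots> = real (n - s) * (real ((n - d) choose (s - d)) * det (gram X))"
    using binomial_step[OF Suc.prems(1) s] by (metis of_nat_mult mult.assoc)
  finally show ?case
    using s by (simp add: F_def)
qed

end

section \<open>Paths in the removal graph and recursion on the last edge\<close>

lemma awalk_removal_dag_distinct:
  assumes "pre_digraph.awalk (with_proj (removal_dag X)) u p v"
  shows "distinct (pre_digraph.awalk_verts (with_proj (removal_dag X)) u p)"
proof -
  interpret pair_fin_digraph "removal_dag X"
    by (rule pair_fin_digraph_removal_dag)
  \<comment> \<open>The subset clause strengthens the induction: everything after the first edge
    lies inside \<open>snd e\<close>, a proper subset of \<open>u\<close>, so \<open>u\<close>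
    cannot recur.\<close>
  have "distinct (awalk_verts u p) \<and> (\<forall>w\<in>set (awalk_verts u p). w \<subseteq> u)"
    using assms
  proof (induction p arbitrary: u)
    case (Cons e p)
    then have e: "e \<in> parcs (removal_dag X)" "fst e = u" and "awalk (snd e) p v"
      by (auto simp: awalk_Cons_iff)
    moreover from e have "snd e \<subset> u"
      by (auto simp: removal_dag_def)
    ultimately show ?case
      using Cons.IH[of "snd e"] by auto
  qed simp
  then show ?thesis by simp
qed

text \<open>Walks and paths coincide in this graph, so appending an edge cannot break distinctness
  of the vertices.\<close>

lemma apath_removal_dag_snoc:
  fixes X defines "G \<equiv> with_proj (removal_dag X)"
  shows "pre_digraph.apath G R (p @ [e]) S \<longleftrightarrow>
    pre_digraph.apath G R p (fst e) \<and> e \<in> parcs (removal_dag X) \<and> snd e = S"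
proof -
  interpret pair_fin_digraph "removal_dag X"
    by (rule pair_fin_digraph_removal_dag)
  have "apath R q T \<longleftrightarrow> awalk R q T" for q T
    using awalk_removal_dag_distinct[of X R q T] by (auto simp: apath_def)
  moreover have "awalk R (p @ [e]) S \<longleftrightarrow> awalk R p (fst e) \<and> e \<in> parcs (removal_dag X) \<and> snd e = S"
    by (auto simp: awalk_simps simp del: awalk_empty_ends)
  ultimately show ?thesis
    by (simp add: G_def)
qed

text \<open>Paths are split by their last edge. As \<open>S\<close> differs from the root, the empty
  path does not occur.\<close>

lemma node_prob_rec:
  assumes S: "S \<subset> {0..<dim_row X}" and card_S: "dim_col X \<le> card S"
  shows "node_prob X S =
    (\<Sum>i\<in>{0..<dim_row X} - S. node_prob X (insert i S) * edge_prob X S (insert i S))"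
proof -
  let ?R = "{0..<dim_row X}"
  interpret pair_fin_digraph "removal_dag X"
    by (rule pair_fin_digraph_removal_dag)
  define P where "P T = {p. apath ?R p T}" for T
  define ext where "ext i = (\<lambda>p. p @ [(insert i S, S)])" for i
  have fin: "finite (P T)" for T
    unfolding P_def by (rule finite_paths)
  have fin_S: "finite S"
    using S finite_subset by blast
  have "P S = (\<Union>i\<in>?R - S. ext i ` P (insert i S))"
  proof (intro equalityI subsetI)
    fix p assume p: "p \<in> P S"
    then have "p \<noteq> []"
      using S by (auto simp: P_def apath_Nil_iff)
    then obtain q e where q: "p = q @ [e]"
      by (cases p rule: rev_cases) auto
    with p have "apath ?R q (fst e)" and e: "e \<in> parcs (removal_dag X)" "snd e = S"
      by (auto simp: P_def apath_removal_dag_snoc)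
    moreover from e obtain T i where "e = (T, T - {i})" "T \<subseteq> ?R" "i \<in> T"
      by (auto simp: removal_dag_def)
    with e have "i \<in> ?R - S" "e = (insert i S, S)"
      by auto
    ultimately show "p \<in> (\<Union>i\<in>?R - S. ext i ` P (insert i S))"
      using q by (auto simp: P_def ext_def)
  next
    fix p assume "p \<in> (\<Union>i\<in>?R - S. ext i ` P (insert i S))"
    then obtain i q where i: "i \<in> ?R - S" and q: "apath ?R q (insert i S)" "p = q @ [(insert i S, S)]"
      by (auto simp: P_def ext_def)
    have "(insert i S, S) \<in> parcs (removal_dag X)"
      using i S card_S fin_S
      by (auto simp: removal_dag_def intro!: exI[of _ "insert i S"] exI[of _ i])
    then show "p \<in> P S"
      using q by (simp add: P_def apath_removal_dag_snoc)
  qed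
  then have "node_prob X S = sum (path_prob X) (\<Union>i\<in>?R - S. ext i ` P (insert i S))"
    by (simp add: node_prob_def P_def)
  \<comment> \<open>The union is disjoint: for \<open>i\<close> outside \<open>S\<close>, the last
    edge \<open>(insert i S, S)\<close> determines \<open>i\<close>.\<close>
  also have "\<dots> = (\<Sum>i\<in>?R - S. sum (path_prob X) (ext i ` P (insert i S)))"
    using fin by (intro sum.UNION_disjoint) (auto simp: ext_def)
  also have "\<dots> = (\<Sum>i\<in>?R - S. node_prob X (insert i S) * edge_prob X S (insert i S))"
  proof (rule sum.cong[OF refl])
    fix i
    have "sum (path_prob X) (ext i ` P (insert i S)) = (\<Sum>p\<in>P (insert i S). path_prob X (ext i p))"
      by (rule sum.reindex_cong) (auto simp: ext_def inj_on_def)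
    also have "\<dots> = node_prob X (insert i S) * edge_prob X S (insert i S)"
      by (simp add: ext_def path_prob_def node_prob_def P_def sum_distrib_right)
    finally show "sum (path_prob X) (ext i ` P (insert i S))
        = node_prob X (insert i S) * edge_prob X S (insert i S)" .
  qed
  finally show ?thesis .
qed

section \<open>The closed form of the node probabilities and the theorem\<close>

lemma node_prob_eq:
  assumes X: "X \<in> carrier_mat n d" and dn: "d \<le> n" and pos: "det (gram X) > 0"
    and "S \<subseteq> {0..<n}" "d \<le> card S"
  shows "node_prob X S = det (gram (rows_submatrix X S)) /
    (real ((n - d) choose (card S - d)) * det (gram X))"
  using assms(4,5)
proof (induction "n - card S" arbitrary: S rule: less_induct)
  case less
  let ?g = "\<lambda>S. det (gram (rows_submatrix X S))" and ?s = "card S"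
  have fin: "finite S"
    using less.prems finite_subset by blast
  show ?case
  proof (cases "S = {0..<n}")
    case True
    then show ?thesis
      using node_prob_root[of X] X dn pos by (simp add: rows_submatrix_all[OF X])
  next
    case False
    with less.prems have S: "S \<subset> {0..<n}" by auto
    then have s: "?s < n"
      using psubset_card_mono[of "{0..<n}" S] by simp
    let ?c = "real (?s + 1 - d)" and ?b = "real ((n - d) choose (?s + 1 - d))"
    have step: "node_prob X (insert i S) * edge_prob X S (insert i S) = ?g S / (?c * ?b * det (gram X))"
      if i: "i \<in> {0..<n} - S" for i
    proof -
      have T: "insert i S \<subseteq> {0..<n}" "card (insert i S) = ?s + 1"
        using i less.prems fin by auto
      then have IH: "node_prob X (insert i S) = ?g (insert i S) / (?b * det (gram X))"
        using less.hyps[of "insert i S"] s less.prems by simp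
      show ?thesis
      proof (cases "?g (insert i S) = 0")
        \<comment> \<open>The edge label is the default \<open>1 / card\<close> here, but the
          predecessor has probability 0 by \<open>IH\<close>, and \<open>?g S\<close> vanishes by
          monotonicity, so both sides are 0.\<close>
        case True
        then show ?thesis
          using IH det_gram_rows_submatrix_eq_0_mono[OF X _ T(1), of S] by auto
      next
        case False
        then have "?g (insert i S) > 0"
          using det_gram_rows_submatrix_nonneg[OF X T(1)] by simp
        then show ?thesis
          using X T less.prems by (simp add: IH edge_prob_def of_nat_diff)
      qed
    qed
    \<comment> \<open>The summand of \<open>step\<close> does not depend on \<open>i\<close>, so it
      is multiplied by the number of predecessors.\<close>
    have "node_prob X S = real (n - ?s) * (?g S / (?c * ?b * det (gram X)))"
      using node_prob_rec[of S X] X S less.prems step fin by (simp add: card_Diff_subset)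
    also have "\<dots> = ?g S / (real ((n - d) choose (?s - d)) * det (gram X))"
    proof -
      have "?c * ?b = real (n - ?s) * real ((n - d) choose (?s - d))"
        using binomial_step[OF less.prems(2) s] by (metis of_nat_mult)
      then show ?thesis
        using s by simp
    qed
    finally show ?thesis .
  qed
qed

theorem theorem2p2:
  fixes X :: "real mat" and n d :: nat
  assumes X: "X \<in> carrier_mat n d"
    and dn: "d \<le> n"
    and pos: "det (gram X) > 0"
  shows
    "(\<forall>S. S \<subseteq> {0..<n} \<longrightarrow> d < card S \<longrightarrow> det (gram (rows_submatrix X S)) > 0 \<longrightarrow>
        (\<forall>i\<in>S.
           edge_prob X (S - {i}) S =
             det (gram (rows_submatrix X (S - {i}))) /
               ((real (card S) - real d) * det (gram (rows_submatrix X S))) \<and>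
           edge_prob X (S - {i}) S =
             (1 - row X i \<bullet> (the (mat_inverse (gram (rows_submatrix X S))) *\<^sub>v row X i)) /
               (real (card S) - real d)) \<and>
        (\<forall>i\<in>S. 0 \<le> edge_prob X (S - {i}) S) \<and>
        (\<Sum>i\<in>S. edge_prob X (S - {i}) S) = 1) \<and>
     (\<forall>s\<in>{d..n}. (\<Sum>S | S \<subseteq> {0..<n} \<and> card S = s. node_prob X S) = 1) \<and>
     (\<forall>S. S \<subseteq> {0..<n} \<longrightarrow> d \<le> card S \<longrightarrow>
        node_prob X S =
          det (gram (rows_submatrix X S)) /
            (real ((n - d) choose (card S - d)) * det (gram X)))"
proof (intro conjI allI impI ballI)
  fix S assume S: "S \<subseteq> {0..<n}" "d < card S" "det (gram (rows_submatrix X S)) > 0"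
  let ?g = "\<lambda>S. det (gram (rows_submatrix X S))"
  show label: "edge_prob X (S - {i}) S = ?g (S - {i}) / ((real (card S) - real d) * ?g S)" for i
    using S X by (simp add: edge_prob_def)
  show "edge_prob X (S - {i}) S =
      (1 - row X i \<bullet> (the (mat_inverse (gram (rows_submatrix X S))) *\<^sub>v row X i)) /
        (real (card S) - real d)" if "i \<in> S" for i
    using det_gram_rows_submatrix_remove[OF X S(1) that] S(3) by (simp add: label)
  show "0 \<le> edge_prob X (S - {i}) S" for i
    using det_gram_rows_submatrix_nonneg[OF X, of "S - {i}"] S
    by (auto simp: label intro!: divide_nonneg_pos)
  show "(\<Sum>i\<in>S. edge_prob X (S - {i}) S) = 1"
    using S by (simp add: label sum_divide_distrib[symmetric] sum_det_gram_remove[OF X S(1)])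
next
  fix s assume s: "s \<in> {d..n}"
  have "(\<Sum>S | S \<subseteq> {0..<n} \<and> card S = s. node_prob X S) =
      (\<Sum>S | S \<subseteq> {0..<n} \<and> card S = s. det (gram (rows_submatrix X S))) /
        (real ((n - d) choose (s - d)) * det (gram X))"
    unfolding sum_divide_distrib
    using s node_prob_eq[OF X dn pos] by (intro sum.cong) auto
  \<comment> \<open>Numerator and denominator agree; the quotient is 1 because
    \<open>s - d \<le> n - d\<close> makes the binomial coefficient nonzero.\<close>
  also have "\<dots> = 1"
    using s pos sum_det_gram_card[OF X, of s] by (simp add: not_less diff_le_mono)
  finally show "(\<Sum>S | S \<subseteq> {0..<n} \<and> card S = s. node_prob X S) = 1" .
next
  fix S assume "S \<subseteq> {0..<n}" "d \<le> card S"
  then show "node_prob X S = det (gram (rows_submatrix X S)) /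
      (real ((n - d) choose (card S - d)) * det (gram X))"
    by (rule node_prob_eq[OF X dn pos])
qed

end
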